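(* Let $(V,\cdot,\circ)$ be a Novikov-Poisson algebra over $\mathbb{C}$ whose product $\cdot$ is not identically zero. If $(V,\cdot,\circ)$ is simple, then the quadratic left-symmetric conformal algebra $R=\mathbb{C}[\partial]V$ corresponding to $(V,\cdot,\circ)$ is simple.
   Context: All vector spaces are over $\mathbb{C}$. A Novikov algebra $(A,\circ)$ is a vector space with a bilinear product satisfying $(a\circ b)\circ c-a\circ(b\circ c)=(b\circ a)\circ c-b\circ(a\circ c)$ and $(a\circ b)\circ c=(a\circ c)\circ b$ for all $a,b,c\in A$. A Novikov-Poisson algebra $(A,\cdot,\circ)$ is a vector space with two bilinear operations such that $(A,\circ)$ is a Novikov algebra, $(A,\cdot)$ is a commutative associative algebra (not necessarily unital), and for all $a,b,c\in A$: $(a\cdot b)\circ c=a\cdot(b\circ c)$ and $(a\circ b)\cdot c-a\circ(b\cdot c)=(b\circ a)\cdot c-b\circ(a\cdot c)$. An ideal is a subspace $I$ with $a\cdot b,\,a\circ b,\,b\circ a\in I$ for all $a\in I$, $b\in A$; it is proper if $I\ne 0,A$. $(A,\cdot,\circ)$ is simple if it is non-trivial (its operations are not both identically zero) and has no proper ideals. A left-symmetric conformal algebra is a $\mathbb{C}[\partial]$-module $R$ with a $\mathbb{C}$-bilinear map $R\times R\to R[\lambda]$, $(a,b)\mapsto a_\lambda b$, such that $\partial a_\lambda b=-\lambda a_\lambda b$, $a_\lambda\partial b=(\partial+\lambda)a_\lambda b$ (conformal sesquilinearity), and $(a_\lambda b)_{\lambda+\mu}c-a_\lambda(b_\mu c)=(b_\mu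 a)_{\lambda+\mu}c-b_\mu(a_\lambda c)$. An ideal of $R$ is a $\mathbb{C}[\partial]$-submodule $I$ with $I_\lambda R\subseteq I[\lambda]$ and $R_\lambda I\subseteq I[\lambda]$; it is proper if $I\neq 0,R$. $R$ is simple if it is non-trivial (its $\lambda$-product is not identically zero) and has no proper ideals. The quadratic left-symmetric conformal algebra corresponding to $(V,\cdot,\circ)$ is the free $\mathbb{C}[\partial]$-module $R=\mathbb{C}[\partial]V=\mathbb{C}[\partial]\otimes V$ with $a_\lambda b=\partial(a\cdot b)+a\circ b+\lambda(a\cdot b)$ for $a,b\in V$, extended by conformal sesquilinearity (this is a left-symmetric conformal algebra). *)

theory Defs
  imports Complex_Main "HOL-Computational_Algebra.Polynomial"
begin

text \<open>
  Vector spaces over the complex numbers are types with an explicit scalar multiplication, of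
  arbitrary (possibly infinite) dimension.
\<close>

definition bilinear_over ::
  "(complex \<Rightarrow> 'a::ab_group_add \<Rightarrow> 'a) \<Rightarrow> (complex \<Rightarrow> 'b::ab_group_add \<Rightarrow> 'b) \<Rightarrow> ('a \<Rightarrow> 'a \<Rightarrow> 'b) \<Rightarrow> bool"
  where "bilinear_over s t f \<longleftrightarrow>
    (\<forall>b. Vector_Spaces.linear s t (\<lambda>a. f a b)) \<and> (\<forall>a. Vector_Spaces.linear s t (\<lambda>b. f a b))"

locale novikov_algebra = vector_space scale
  for scale :: "complex \<Rightarrow> 'v::ab_group_add \<Rightarrow> 'v" +
  fixes circ :: "'v \<Rightarrow> 'v \<Rightarrow> 'v"  (infixl \<open>\<circ>\<^sub>N\<close> 70)
  assumes circ_bilinear: "bilinear_over scale scale (\<circ>\<^sub>N)"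
    and left_symmetric:
      "(a \<circ>\<^sub>N b) \<circ>\<^sub>N c - a \<circ>\<^sub>N (b \<circ>\<^sub>N c) = (b \<circ>\<^sub>N a) \<circ>\<^sub>N c - b \<circ>\<^sub>N (a \<circ>\<^sub>N c)"
    and right_commute: "(a \<circ>\<^sub>N b) \<circ>\<^sub>N c = (a \<circ>\<^sub>N c) \<circ>\<^sub>N b"

locale novikov_poisson_algebra = novikov_algebra scale circ
  for scale :: "complex \<Rightarrow> 'v::ab_group_add \<Rightarrow> 'v"
    and dot :: "'v \<Rightarrow> 'v \<Rightarrow> 'v"  (infixl \<open>\<bullet>\<^sub>N\<close> 70)
    and circ :: "'v \<Rightarrow> 'v \<Rightarrow> 'v"  (infixl \<open>\<circ>\<^sub>N\<close> 70) +
  assumes dot_bilinear: "bilinear_over scale scale (\<bullet>\<^sub>N)"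
    and dot_commute: "a \<bullet>\<^sub>N b = b \<bullet>\<^sub>N a"
    and dot_assoc: "(a \<bullet>\<^sub>N b) \<bullet>\<^sub>N c = a \<bullet>\<^sub>N (b \<bullet>\<^sub>N c)"
    and dot_circ: "(a \<bullet>\<^sub>N b) \<circ>\<^sub>N c = a \<bullet>\<^sub>N (b \<circ>\<^sub>N c)"
    and circ_dot:
      "(a \<circ>\<^sub>N b) \<bullet>\<^sub>N c - a \<circ>\<^sub>N (b \<bullet>\<^sub>N c) = (b \<circ>\<^sub>N a) \<bullet>\<^sub>N c - b \<circ>\<^sub>N (a \<bullet>\<^sub>N c)"
begin

definition np_ideal :: "'v set \<Rightarrow> bool"
  where "np_ideal I \<longleftrightarrow> subspace I \<and>
    (\<forall>a\<in>I. \<forall>b. a \<bullet>\<^sub>N b \<in> I \<and> a \<circ>\<^sub>N b \<in> I \<and> b \<circ>\<^sub>N a \<in> I)"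

end

locale simple_novikov_poisson_algebra = novikov_poisson_algebra +
  assumes nontrivial: "\<not> ((\<forall>a b. dot a b = 0) \<and> (\<forall>a b. circ a b = 0))"
    and no_proper_ideal: "\<not> (\<exists>I. np_ideal I \<and> I \<noteq> {0} \<and> I \<noteq> UNIV)"

text \<open>
  If \<open>p = \<Sum>i. c\<^sub>i x\<^sup>i\<close> is a formal polynomial, then \<open>poly_subst X f p = \<Sum>i. X\<^sup>i (f c\<^sub>i)\<close>: the
  variable is replaced by the operator \<open>X\<close> and the coefficients are mapped by \<open>f\<close>.
\<close>

definition poly_subst :: "('b \<Rightarrow> 'b) \<Rightarrow> ('a::zero \<Rightarrow> 'b::comm_monoid_add) \<Rightarrow> 'a poly \<Rightarrow> 'b"
  where "poly_subst X f p = (\<Sum>i\<le>degree p. (X ^^ i) (f (coeff p i)))"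

text \<open>
  A module over the polynomial ring in \<open>\<partial>\<close> is given by the action \<open>act\<close> of \<^typ>\<open>complex poly\<close>;
  \<open>R[\<lambda>]\<close> is \<^typ>\<open>'r poly\<close>. For \<open>R[\<lambda>,\<mu>]\<close> we take \<^typ>\<open>'r poly poly\<close>, where the outer variable is \<open>\<mu>\<close>
  and the inner one is \<open>\<lambda>\<close>. The next three operators are multiplication by \<open>\<lambda>\<close>, by \<open>\<mu>\<close> and by
  \<open>\<lambda> + \<mu>\<close>, and \<open>lam_prod X lprod a b\<close> is \<open>a\<^sub>x b\<close> in \<open>R[\<lambda>,\<mu>]\<close>, where \<open>X\<close> is multiplication
  by \<open>x\<close>.
\<close>

definition mult_lam :: "'r::zero poly poly \<Rightarrow> 'r poly poly"
  where "mult_lam = map_poly (pCons 0)"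

definition mult_mu :: "'r::zero poly poly \<Rightarrow> 'r poly poly"
  where "mult_mu = pCons 0"

definition mult_lam_mu :: "'r::comm_monoid_add poly poly \<Rightarrow> 'r poly poly"
  where "mult_lam_mu p = mult_lam p + mult_mu p"

definition lam_prod ::
  "('r::comm_monoid_add poly poly \<Rightarrow> 'r poly poly) \<Rightarrow> ('r \<Rightarrow> 'r \<Rightarrow> 'r poly) \<Rightarrow> 'r \<Rightarrow> 'r \<Rightarrow> 'r poly poly"
  where "lam_prod X lprod a b = poly_subst X (\<lambda>v. [:[:v:]:]) (lprod a b)"

locale left_symmetric_conformal_algebra = module act
  for act :: "complex poly \<Rightarrow> 'r::ab_group_add \<Rightarrow> 'r" +
  fixes lprod :: "'r \<Rightarrow> 'r \<Rightarrow> 'r poly"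
  assumes lprod_bilinear:
      "bilinear_over (\<lambda>z. act [:z:]) (\<lambda>z. map_poly (act [:z:])) lprod"
    and sesquilinear_left: "lprod (act [:0, 1:] a) b = - pCons 0 (lprod a b)"
    and sesquilinear_right:
      "lprod a (act [:0, 1:] b) = map_poly (act [:0, 1:]) (lprod a b) + pCons 0 (lprod a b)"
    and conformal_left_symmetric:
      "poly_subst mult_lam (\<lambda>u. lam_prod mult_lam_mu lprod u c) (lprod a b)
         - poly_subst mult_mu (\<lambda>u. lam_prod mult_lam lprod a u) (lprod b c)
       = poly_subst mult_mu (\<lambda>u. lam_prod mult_lam_mu lprod u c) (lprod b a)
         - poly_subst mult_lam (\<lambda>u. lam_prod mult_mu lprod b u) (lprod a c)"
begin

definition conformal_ideal :: "'r set \<Rightarrow> bool"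
  where "conformal_ideal I \<longleftrightarrow> subspace I \<and>
    (\<forall>a\<in>I. \<forall>b. (\<forall>n. coeff (lprod a b) n \<in> I) \<and> (\<forall>n. coeff (lprod b a) n \<in> I))"

end

locale simple_left_symmetric_conformal_algebra = left_symmetric_conformal_algebra +
  assumes nontrivial: "\<not> (\<forall>a b. lprod a b = 0)"
    and no_proper_ideal: "\<not> (\<exists>I. conformal_ideal I \<and> I \<noteq> {0} \<and> I \<noteq> UNIV)"

text \<open>
  The free module generated by \<open>V\<close> is \<^typ>\<open>'v poly\<close>, with \<open>\<partial>\<close> as the variable (\<open>\<partial>\<close> acts as
  \<^term>\<open>pCons 0\<close>), and \<open>R[\<lambda>]\<close> is \<^typ>\<open>'v poly poly\<close>, with outer variable \<open>\<lambda>\<close> and inner variable \<open>\<partial>\<close>.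
\<close>

definition free_act :: "(complex \<Rightarrow> 'v::comm_monoid_add \<Rightarrow> 'v) \<Rightarrow> complex poly \<Rightarrow> 'v poly \<Rightarrow> 'v poly"
  where "free_act scale p r = poly_subst (pCons 0) (\<lambda>z. map_poly (scale z) r) p"

text \<open>\<open>a\<^sub>\<lambda> b = (a \<circ> b + \<partial>(a \<cdot> b)) + \<lambda>(a \<cdot> b)\<close> for \<open>a\<close> and \<open>b\<close> in \<open>V\<close>\<close>

definition quadratic_gen :: "('v \<Rightarrow> 'v \<Rightarrow> 'v::zero) \<Rightarrow> ('v \<Rightarrow> 'v \<Rightarrow> 'v) \<Rightarrow> 'v \<Rightarrow> 'v \<Rightarrow> 'v poly poly"
  where "quadratic_gen dot circ a b = [:[:circ a b, dot a b:], [:dot a b:]:]"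

text \<open>
  The extension by sesquilinearity,
  \<open>(\<Sum>i. \<partial>\<^sup>i a\<^sub>i)\<^sub>\<lambda> (\<Sum>j. \<partial>\<^sup>j b\<^sub>j) = \<Sum>i. \<Sum>j. (- \<lambda>)\<^sup>i (\<partial> + \<lambda>)\<^sup>j (a\<^sub>i)\<^sub>\<lambda> (b\<^sub>j)\<close>
\<close>

definition quadratic_prod ::
  "('v \<Rightarrow> 'v \<Rightarrow> 'v::ab_group_add) \<Rightarrow> ('v \<Rightarrow> 'v \<Rightarrow> 'v) \<Rightarrow> 'v poly \<Rightarrow> 'v poly \<Rightarrow> 'v poly poly"
  where "quadratic_prod dot circ f g =
    poly_subst (\<lambda>p. - pCons 0 p)
      (\<lambda>a. poly_subst (\<lambda>p. map_poly (pCons 0) p + pCons 0 p) (\<lambda>b. quadratic_gen dot circ a b) g) f"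

lemma quadratic_prod_generators:
  "quadratic_prod dot circ [:a:] [:b:] = [:[:circ a b, dot a b:], [:dot a b:]:]"
  by (simp add: quadratic_prod_def poly_subst_def quadratic_gen_def)

end

theory Submission
  imports Defs
begin

text \<open>
  Let \<open>I\<close> be an ideal of \<open>R = \<complex>[\<partial>]V\<close>. The elements of \<open>V\<close> that lie in \<open>I\<close> form an ideal of the
  Novikov-Poisson algebra, because \<open>a\<^sub>\<lambda> b\<close> carries \<open>a \<cdot> b\<close> in its \<open>\<lambda>\<close>-coefficient and
  \<open>\<partial>(a \<cdot> b) + a \<circ> b\<close> in its constant one. So this ideal is \<open>V\<close>, and then \<open>I = R\<close>
  (\<open>ideal_containing_constants\<close>), or \<open>I \<inter> V = 0\<close>.

  Suppose \<open>I \<inter> V = 0\<close> and let \<open>f = \<Sum>i. \<partial>\<^sup>i a\<^sub>i\<close> be in \<open>I\<close>, of degree \<open>m\<close>. For \<open>b\<close> in \<open>V\<close>,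
  collecting powers of \<open>\<partial> + \<lambda>\<close> gives \<open>b\<^sub>\<lambda> f = \<Sum>i. (\<partial> + \<lambda>)\<^sup>i h\<^sub>i\<close>, where \<open>h\<^sub>i\<close> is
  \<open>b \<circ> a\<^sub>i\<close> plus the product of \<open>b\<close> with the preceding coefficient of \<open>f\<close>. The coefficient of the
  highest power of \<open>\<lambda>\<close> is the last nonzero \<open>h\<^sub>i\<close>, an element of \<open>I \<inter> V\<close>; so all \<open>h\<^sub>i\<close> vanish.
  In degree \<open>m + 1\<close> this says \<open>b \<cdot> a\<^sub>m = 0\<close>, and in degree \<open>m\<close> it computes \<open>b \<circ> a\<^sub>m\<close>. Comparing
  with the coefficient of \<open>\<lambda>\<^sup>m\<close> in \<open>f\<^sub>\<lambda> b\<close>, which computes \<open>a\<^sub>m \<circ> b\<close>, one finds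
  \<open>b \<circ> a\<^sub>m = - (a\<^sub>m \<circ> b)\<close>. So \<open>a\<^sub>m\<close> lies in
  \<open>K = {a. \<forall>b. a \<cdot> b = 0 \<and> b \<circ> a = - (a \<circ> b)}\<close> (\<open>lead_coeff_in_skew_annihilator\<close>).

  The point is that \<open>K\<close> is an ideal of \<open>V\<close> (\<open>np_ideal_skew_annihilator\<close>). It annihilates \<open>V\<close>
  under \<open>\<cdot>\<close>, so it is not \<open>V\<close>, and simplicity gives \<open>K = 0\<close>. Hence every element of \<open>I\<close> has
  leading coefficient \<open>0\<close>, that is, \<open>I = 0\<close>.

  That \<open>R\<close> is a left-symmetric conformal algebra at all is a computation on generators
  (\<open>associator_generators\<close>): both sides of the left-symmetry identity are sesquilinear in each of
  the three arguments, so it is enough to check it on \<open>V\<close> (\<open>left_symmetric_from_generators\<close>).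
\<close>

section \<open>Substitution of additive operators\<close>

lemma poly_subst_0: "f 0 = 0 \<Longrightarrow> poly_subst X f 0 = 0"
  by (simp add: poly_subst_def)

lemma poly_subst_const: "poly_subst X f [:a:] = f a"
  by (simp add: poly_subst_def)

lemma poly_subst_pCons:
  assumes "additive X" "f 0 = 0"
  shows "poly_subst X f (pCons a p) = f a + X (poly_subst X f p)"
proof (cases "p = 0")
  case True
  then show ?thesis using assms by (simp add: poly_subst_def additive.zero[OF assms(1)])
next
  case False
  then show ?thesis
    by (simp add: poly_subst_def sum.atMost_Suc_shift additive.sum[OF assms(1)] del: sum.atMost_Suc)
qed

lemma poly_subst_add:
  assumes X: "additive X" and f: "additive f"
  shows "poly_subst X f (p + q) = poly_subst X f p + poly_subst X f q"
proof -
  note f0 = additive.zero[OF f]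
  show ?thesis
    by (induction p q rule: poly_induct2)
      (simp_all add: poly_subst_0 poly_subst_pCons X f f0 additive.add[OF X] additive.add[OF f])
qed

lemma additive_poly_subst: "additive X \<Longrightarrow> additive f \<Longrightarrow> additive (poly_subst X f)"
  by (simp add: additive_def poly_subst_add)

lemma poly_subst_fun_add:
  assumes X: "additive X" and "f 0 = 0" "g 0 = 0"
  shows "poly_subst X (\<lambda>u. f u + g u) p = poly_subst X f p + poly_subst X g p"
  by (induction p) (simp_all add: poly_subst_0 poly_subst_pCons assms additive.add[OF X])

text \<open>
  An operator that commutes with the substituted one can be pulled out of the substitution. Together
  with \<open>poly_subst_pCons\<close> this carries all the sesquilinearity rules below.
\<close>
lemma poly_subst_commute:
  assumes X: "additive X" and W: "additive W" and "f 0 = 0"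
    and "\<And>v. W (X v) = X (W v)"
  shows "poly_subst X (\<lambda>u. W (f u)) p = W (poly_subst X f p)"
  by (induction p)
    (simp_all add: poly_subst_0 poly_subst_pCons assms additive.add[OF W] additive.zero[OF W])

lemma poly_subst_map_poly:
  assumes X: "additive X" and "f 0 = 0" "g 0 = 0"
  shows "poly_subst X f (map_poly g p) = poly_subst X (\<lambda>u. f (g u)) p"
  by (induction p) (simp_all add: poly_subst_0 poly_subst_pCons assms map_poly_pCons)

lemma additive_pCons_0: "additive (pCons 0 :: 'a::ab_group_add poly \<Rightarrow> _)"
  by (simp add: additive_def)

lemma additive_map_poly: "additive f \<Longrightarrow> additive (map_poly f)"
  by (auto simp: additive_def poly_eq_iff coeff_map_poly additive.zero[of f])

lemma additive_plus: "additive f \<Longrightarrow> additive g \<Longrightarrow> additive (\<lambda>x. f x + g x)"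
  by (simp add: additive_def algebra_simps)

lemma additive_uminus: "additive f \<Longrightarrow> additive (\<lambda>x. - f x)"
  by (simp add: additive_def algebra_simps)

lemma additive_compose: "additive f \<Longrightarrow> additive g \<Longrightarrow> additive (\<lambda>x. f (g x))"
  by (simp add: additive_def)

section \<open>The free module\<close>

lemma vector_space_map_poly:
  fixes s :: "complex \<Rightarrow> 'v::ab_group_add \<Rightarrow> 'v"
  assumes "vector_space s"
  shows "vector_space (\<lambda>z. map_poly (s z))"
proof -
  interpret vector_space s by fact
  show ?thesis
    by unfold_locales (simp_all add: poly_eq_iff coeff_map_poly algebra_simps)
qed

lemma additive_scale: "vector_space s \<Longrightarrow> additive (s z)"
  by (simp add: additive_def vector_space.vector_space_assms(1))

lemma free_act_pCons:
  assumes "vector_space scale"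
  shows "free_act scale (pCons z p) r = map_poly (scale z) r + pCons 0 (free_act scale p r)"
proof -
  interpret V: vector_space "\<lambda>z. map_poly (scale z)" by (rule vector_space_map_poly[OF assms])
  show ?thesis
    by (simp add: free_act_def poly_subst_pCons additive_pCons_0)
qed

lemma free_act_0:
  assumes "vector_space scale"
  shows "free_act scale 0 r = 0"
proof -
  interpret V: vector_space "\<lambda>z. map_poly (scale z)" by (rule vector_space_map_poly[OF assms])
  show ?thesis by (simp add: free_act_def poly_subst_0)
qed

lemma free_act_const:
  assumes "vector_space scale"
  shows "free_act scale [:z:] = map_poly (scale z)"
  by (rule ext) (simp add: free_act_pCons free_act_0 assms)

lemma free_act_var:
  assumes "vector_space scale"
  shows "free_act scale [:0, 1:] = pCons 0"
proof -
  interpret V: vector_space "\<lambda>z. map_poly (scale z)" by (rule vector_space_map_poly[OF assms])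
  show ?thesis by (rule ext) (simp add: free_act_pCons free_act_0 assms)
qed

lemma module_free_act:
  assumes "vector_space scale"
  shows "module (free_act scale)"
proof -
  interpret S: vector_space scale by fact
  interpret V: vector_space "\<lambda>z. map_poly (scale z)" by (rule vector_space_map_poly[OF assms])
  note simps = free_act_pCons[OF assms] free_act_0[OF assms]
  have scale_pCons: "map_poly (scale z) (pCons 0 r) = pCons 0 (map_poly (scale z) r)" for z r
    by (simp add: map_poly_pCons)
  have add_right: "free_act scale p (x + y) = free_act scale p x + free_act scale p y" for p x y
    by (induction p) (simp_all add: simps V.scale_right_distrib add_ac)
  have add_left: "free_act scale (p + q) x = free_act scale p x + free_act scale q x" for p q x
    by (induction p q rule: poly_induct2) (simp_all add: simps V.scale_left_distrib)
  have smult: "free_act scale (smult z p) x = map_poly (scale z) (free_act scale p x)" for z p x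
    by (induction p) (simp_all add: simps V.scale_right_distrib scale_pCons flip: V.scale_scale)
  have mult: "free_act scale (p * q) x = free_act scale p (free_act scale q x)" for p q x
    by (induction p) (simp_all add: simps add_left smult)
  have one: "free_act scale 1 x = x" for x
    by (simp add: one_pCons simps)
  show ?thesis
    by unfold_locales (simp_all add: add_right add_left mult one)
qed

section \<open>Sesquilinear products\<close>

locale sesquilinear_product =
  fixes lprod :: "'v::ab_group_add poly \<Rightarrow> 'v poly \<Rightarrow> 'v poly poly"
  assumes add_left: "additive (\<lambda>a. lprod a b)"
    and add_right: "additive (lprod a)"
    and sesqui_left: "lprod (pCons 0 a) b = - pCons 0 (lprod a b)"
    and sesqui_right: "lprod a (pCons 0 b) = map_poly (pCons 0) (lprod a b) + pCons 0 (lprod a b)"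

text \<open>The action of \<open>\<partial>\<close> on the coefficients of \<open>R[\<lambda>,\<mu>]\<close>, where \<open>R = \<complex>[\<partial>]V\<close>.\<close>
definition mult_del :: "'v::zero poly poly poly \<Rightarrow> 'v poly poly poly"
  where "mult_del = map_poly (map_poly (pCons 0))"

lemma additive_mult_del: "additive mult_del"
  and additive_mult_lam: "additive mult_lam"
  and additive_mult_mu: "additive mult_mu"
  unfolding mult_del_def mult_lam_def mult_mu_def
  by (intro additive_map_poly additive_pCons_0)+

lemma mult_lam_mu_commute: "mult_lam (mult_mu p) = mult_mu (mult_lam p)"
  and mult_del_lam_commute: "mult_del (mult_lam q) = mult_lam (mult_del q)"
  and mult_del_mu_commute: "mult_del (mult_mu q) = mult_mu (mult_del q)"
  by (simp_all add: mult_del_def mult_lam_def mult_mu_def poly_eq_iff coeff_map_poly coeff_pCons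
      split: nat.split)

text \<open>
  The left-symmetry identity has two sides that differ by exchanging \<open>a\<close> with \<open>b\<close> and \<open>\<lambda>\<close> with
  \<open>\<mu>\<close>. The two variables are abstracted to operators \<open>X\<close> and \<open>Y\<close>, so that each calculation covers
  both sides.
\<close>
locale commuting_variables =
  fixes X Y :: "'v::ab_group_add poly poly poly \<Rightarrow> 'v poly poly poly"
  assumes additive_X: "additive X" and additive_Y: "additive Y"
    and X_Y: "X (Y p) = Y (X p)"
    and D_X: "mult_del (X p) = X (mult_del p)"
    and D_Y: "mult_del (Y p) = Y (mult_del p)"
begin

lemma additive_XY: "additive (\<lambda>p. X p + Y p)"
  by (rule additive_plus[OF additive_X additive_Y])

lemmas var_simps =
  additive.add[OF additive_X] additive.add[OF additive_Y] additive.add[OF additive_mult_del]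
  additive.minus[OF additive_X] additive.minus[OF additive_Y] additive.minus[OF additive_mult_del]
  additive.zero[OF additive_X] additive.zero[OF additive_Y] additive.zero[OF additive_mult_del]
  additive.diff[OF additive_X] additive.diff[OF additive_Y] additive.diff[OF additive_mult_del]
  X_Y D_X D_Y

end

lemma commuting_lam_mu: "commuting_variables mult_lam mult_mu"
  and commuting_mu_lam: "commuting_variables mult_mu mult_lam"
  by (simp_all add: commuting_variables_def additive_mult_lam additive_mult_mu
      mult_lam_mu_commute mult_del_lam_commute mult_del_mu_commute)

context sesquilinear_product
begin

text \<open>\<open>(a\<^sub>x b)\<^bsub>x+y\<^esub> c\<close>\<close>
definition left_nested where
  "left_nested X Y a b c = poly_subst X (\<lambda>u. lam_prod (\<lambda>p. X p + Y p) lprod u c) (lprod a b)"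

text \<open>\<open>a\<^sub>x (b\<^sub>y c)\<close>\<close>
definition right_nested where
  "right_nested X Y a b c = poly_subst Y (\<lambda>u. lam_prod X lprod a u) (lprod b c)"

definition associator where
  "associator X Y a b c = left_nested X Y a b c - right_nested X Y a b c"

lemma additive_embed: "additive (\<lambda>v. [:[:v:]:])"
  by (simp add: additive_def)

lemma additive_lam_prod:
  assumes "additive X"
  shows "additive (\<lambda>a. lam_prod X lprod a b)" "additive (lam_prod X lprod a)"
  unfolding lam_prod_def
  by (intro additive_compose[OF additive_poly_subst] assms additive_embed add_left add_right)+

lemma lam_prod_zero:
  assumes "additive X"
  shows "lam_prod X lprod 0 b = 0" "lam_prod X lprod a 0 = 0"
  using additive.zero[OF additive_lam_prod(1)[OF assms]]
    additive.zero[OF additive_lam_prod(2)[OF assms]] by auto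

lemma lam_prod_sesqui_left:
  assumes "additive X"
  shows "lam_prod X lprod (pCons 0 a) b = - X (lam_prod X lprod a b)"
proof -
  have "lam_prod X lprod (pCons 0 a) b = - poly_subst X (\<lambda>v. [:[:v:]:]) (pCons 0 (lprod a b))"
    unfolding lam_prod_def sesqui_left
    by (rule additive.minus[OF additive_poly_subst[OF assms additive_embed]])
  then show ?thesis by (simp add: lam_prod_def poly_subst_pCons assms)
qed

lemma lam_prod_sesqui_right:
  assumes X: "additive X" and D: "\<And>p. mult_del (X p) = X (mult_del p)"
  shows "lam_prod X lprod a (pCons 0 b) = mult_del (lam_prod X lprod a b) + X (lam_prod X lprod a b)"
proof -
  have "poly_subst X (\<lambda>v. [:[:pCons 0 v:]:]) q = mult_del (poly_subst X (\<lambda>v. [:[:v:]:]) q)" for q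
    using poly_subst_commute[OF X additive_mult_del, of "\<lambda>v. [:[:v:]:]" q] D
    by (simp add: mult_del_def map_poly_pCons)
  then show ?thesis
    by (simp add: lam_prod_def sesqui_right poly_subst_add[OF X additive_embed]
        poly_subst_map_poly[OF X] poly_subst_pCons[OF X])
qed

end

locale nested_products = sesquilinear_product lprod + commuting_variables X Y
  for lprod :: "'v::ab_group_add poly \<Rightarrow> 'v poly \<Rightarrow> 'v poly poly"
    and X Y :: "'v poly poly poly \<Rightarrow> 'v poly poly poly"
begin

lemmas lam_additive =
  additive_lam_prod[OF additive_X] additive_lam_prod[OF additive_Y] additive_lam_prod[OF additive_XY]

lemma left_nested_add:
  "additive (\<lambda>a. left_nested X Y a b c)"
  "additive (\<lambda>b. left_nested X Y a b c)"
  "additive (\<lambda>c. left_nested X Y a b c)"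
proof -
  show "additive (\<lambda>a. left_nested X Y a b c)" "additive (\<lambda>b. left_nested X Y a b c)"
    unfolding left_nested_def
    by (intro additive_compose[OF additive_poly_subst] additive_X lam_additive add_left add_right)+
  show "additive (\<lambda>c. left_nested X Y a b c)"
    unfolding left_nested_def
    by (simp add: additive_def additive.add[OF lam_additive(6)]
        poly_subst_fun_add[OF additive_X] lam_prod_zero[OF additive_XY])
qed

lemma right_nested_add:
  "additive (\<lambda>a. right_nested X Y a b c)"
  "additive (\<lambda>b. right_nested X Y a b c)"
  "additive (\<lambda>c. right_nested X Y a b c)"
proof -
  show "additive (\<lambda>b. right_nested X Y a b c)" "additive (\<lambda>c. right_nested X Y a b c)"
    unfolding right_nested_def
    by (intro additive_compose[OF additive_poly_subst] additive_Y lam_additive add_left add_right)+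
  show "additive (\<lambda>a. right_nested X Y a b c)"
  proof -
    have "lam_prod X lprod (a + a') = (\<lambda>u. lam_prod X lprod a u + lam_prod X lprod a' u)" for a a'
      by (rule ext) (rule additive.add[OF lam_additive(1)])
    then show ?thesis
      unfolding right_nested_def
      by (simp add: additive_def poly_subst_fun_add[OF additive_Y] lam_prod_zero[OF additive_X])
  qed
qed

text \<open>
  Both nested products transform in the same way: \<open>\<partial>\<close> on the three arguments becomes \<open>- x\<close>,
  \<open>- y\<close> and \<open>\<partial> + x + y\<close>. For the middle argument of the left one, \<open>\<partial>\<close> in \<open>a\<^sub>x (\<partial> b)\<close> turns into
  \<open>\<partial> + x\<close>, and the outer product turns this \<open>\<partial>\<close> into \<open>- (x + y)\<close>.
\<close>
lemma left_nested_sesqui: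
  "left_nested X Y (pCons 0 a) b c = - X (left_nested X Y a b c)"
  "left_nested X Y a (pCons 0 b) c = - Y (left_nested X Y a b c)"
  "left_nested X Y a b (pCons 0 c) =
    mult_del (left_nested X Y a b c) + X (left_nested X Y a b c) + Y (left_nested X Y a b c)"
proof -
  let ?G = "\<lambda>u. lam_prod (\<lambda>p. X p + Y p) lprod u c"
  note G = additive_lam_prod(1)[OF additive_XY]
  note G0 = lam_prod_zero[OF additive_XY]
  note S = additive_poly_subst[OF additive_X G]
  show "left_nested X Y (pCons 0 a) b c = - X (left_nested X Y a b c)"
    unfolding left_nested_def sesqui_left
    by (simp add: additive.minus[OF S] poly_subst_pCons[OF additive_X] G0 var_simps)
  have "poly_subst X (\<lambda>u. ?G (pCons 0 u)) q
    = - (X (poly_subst X ?G q) + Y (poly_subst X ?G q))" for q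
    unfolding lam_prod_sesqui_left[OF additive_XY]
    by (rule poly_subst_commute[OF additive_X additive_uminus[OF additive_XY]])
       (simp_all add: G0 var_simps)
  then show "left_nested X Y a (pCons 0 b) c = - Y (left_nested X Y a b c)"
    unfolding left_nested_def sesqui_right
    by (simp add: additive.add[OF S] poly_subst_map_poly[OF additive_X]
        poly_subst_pCons[OF additive_X] G0)
  let ?W = "\<lambda>p. mult_del p + (X p + Y p)"
  have "lam_prod (\<lambda>p. X p + Y p) lprod u (pCons 0 c) = ?W (?G u)" for u
    by (rule lam_prod_sesqui_right[OF additive_XY]) (simp add: var_simps)
  moreover have "poly_subst X (\<lambda>u. ?W (?G u)) q = ?W (poly_subst X ?G q)" for q
    by (rule poly_subst_commute[OF additive_X additive_plus[OF additive_mult_del additive_XY]])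
       (simp_all add: G0 var_simps)
  ultimately show "left_nested X Y a b (pCons 0 c) =
    mult_del (left_nested X Y a b c) + X (left_nested X Y a b c) + Y (left_nested X Y a b c)"
    unfolding left_nested_def by (simp add: add.assoc)
qed

lemma right_nested_sesqui:
  "right_nested X Y (pCons 0 a) b c = - X (right_nested X Y a b c)"
  "right_nested X Y a (pCons 0 b) c = - Y (right_nested X Y a b c)"
  "right_nested X Y a b (pCons 0 c) =
    mult_del (right_nested X Y a b c) + X (right_nested X Y a b c) + Y (right_nested X Y a b c)"
proof -
  let ?G = "lam_prod X lprod a"
  note G = additive_lam_prod(2)[OF additive_X]
  note G0 = lam_prod_zero[OF additive_X]
  note S = additive_poly_subst[OF additive_Y G]
  show "right_nested X Y a (pCons 0 b) c = - Y (right_nested X Y a b c)"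
    unfolding right_nested_def sesqui_left
    by (simp add: additive.minus[OF S] poly_subst_pCons[OF additive_Y] G0 var_simps)
  have "poly_subst Y (\<lambda>u. - X (?G u)) q = - X (poly_subst Y ?G q)" for q
    by (rule poly_subst_commute[OF additive_Y additive_uminus[OF additive_X]])
       (simp_all add: G0 var_simps)
  then show "right_nested X Y (pCons 0 a) b c = - X (right_nested X Y a b c)"
    unfolding right_nested_def lam_prod_sesqui_left[OF additive_X] by simp
  let ?W = "\<lambda>p. mult_del p + X p"
  have "?G (pCons 0 u) = ?W (?G u)" for u
    by (rule lam_prod_sesqui_right[OF additive_X]) (simp add: var_simps)
  moreover have "poly_subst Y (\<lambda>u. ?W (?G u)) q = ?W (poly_subst Y ?G q)" for q
    by (rule poly_subst_commute[OF additive_Y additive_plus[OF additive_mult_del additive_X]])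
       (simp_all add: G0 var_simps)
  ultimately show "right_nested X Y a b (pCons 0 c) =
    mult_del (right_nested X Y a b c) + X (right_nested X Y a b c) + Y (right_nested X Y a b c)"
    unfolding right_nested_def sesqui_right
    by (simp add: additive.add[OF S] poly_subst_map_poly[OF additive_Y]
        poly_subst_pCons[OF additive_Y] G0)
qed

end

text \<open>
  A map for which \<open>\<partial>\<close> can be moved outside is determined by its values on \<open>V\<close>. For sesquilinear
  maps \<open>W\<close> is one of \<open>- \<lambda>\<close>, \<open>- \<mu>\<close> and \<open>\<partial> + \<lambda> + \<mu>\<close>.
\<close>
lemma additive_poly_eq_0:
  fixes T :: "'v::ab_group_add poly \<Rightarrow> 'w::ab_group_add"
  assumes T: "additive T"
    and W: "\<And>q. T (pCons 0 q) = W (T q)" "W 0 = 0"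
    and const: "\<And>v. T [:v:] = 0"
  shows "T p = 0"
proof (induction p)
  case 0
  show ?case by (rule additive.zero[OF T])
next
  case (pCons v p)
  have "T (pCons v p) = T [:v:] + T (pCons 0 p)"
    by (simp flip: additive.add[OF T])
  then show ?case using pCons by (simp add: W const)
qed

context sesquilinear_product
begin

lemma left_symmetric_from_generators:
  assumes gen: "\<And>a b c. associator mult_lam mult_mu [:a:] [:b:] [:c:]
    = associator mult_mu mult_lam [:b:] [:a:] [:c:]"
  shows "associator mult_lam mult_mu a b c = associator mult_mu mult_lam b a c"
proof -
  interpret straight: nested_products lprod mult_lam mult_mu
    by (intro nested_products.intro commuting_lam_mu sesquilinear_product_axioms)
  interpret swapped: nested_products lprod mult_mu mult_lam
    by (intro nested_products.intro commuting_mu_lam sesquilinear_product_axioms)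
  define F where "F a b c = associator mult_lam mult_mu a b c - associator mult_mu mult_lam b a c"
    for a b c
  note adds = straight.left_nested_add straight.right_nested_add
    swapped.left_nested_add swapped.right_nested_add
  note sesq = straight.left_nested_sesqui straight.right_nested_sesqui
    swapped.left_nested_sesqui swapped.right_nested_sesqui
  note simps = additive_def F_def associator_def adds[THEN additive.add] sesq
    straight.var_simps algebra_simps
  have gens: "F [:a:] [:b:] [:c:] = 0" for a b c
    using gen[of a b c] by (simp add: F_def)
  have gen2: "F [:a:] [:b:] c = 0" for a b
    by (rule additive_poly_eq_0[where T = "\<lambda>c. F [:a:] [:b:] c"
          and W = "\<lambda>p. mult_del p + mult_lam p + mult_mu p"])
      (rule gens | simp add: simps)+
  have gen1: "F [:a:] b c = 0" for a
    by (rule additive_poly_eq_0[where T = "\<lambda>b. F [:a:] b c" and W = "\<lambda>p. - mult_mu p"])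
      (rule gen2 | simp add: simps)+
  have "F a b c = 0"
    by (rule additive_poly_eq_0[where T = "\<lambda>a. F a b c" and W = "\<lambda>p. - mult_lam p"])
      (rule gen1 | simp add: simps)+
  then show ?thesis by (simp add: F_def)
qed

end

section \<open>The quadratic conformal algebra\<close>

text \<open>
  Multiplication by \<open>- \<lambda>\<close> and by \<open>\<partial> + \<lambda>\<close> on \<open>R[\<lambda>]\<close>. They are constants so that
  simplification, which pushes a minus sign into the coefficients, leaves these operators intact.
\<close>
definition neg_lam :: "'v::ab_group_add poly poly \<Rightarrow> 'v poly poly"
  where "neg_lam p = - pCons 0 p"

definition del_plus_lam :: "'v::ab_group_add poly poly \<Rightarrow> 'v poly poly"
  where "del_plus_lam p = map_poly (pCons 0) p + pCons 0 p"

lemma additive_neg_lam: "additive neg_lam"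
  unfolding neg_lam_def by (intro additive_uminus additive_pCons_0)

lemma additive_del_plus_lam: "additive del_plus_lam"
  unfolding del_plus_lam_def by (intro additive_plus additive_map_poly additive_pCons_0)

lemma coeff_del_plus_lam: "coeff (del_plus_lam p) n = pCons 0 (coeff p n) + coeff (pCons 0 p) n"
  by (simp add: del_plus_lam_def coeff_map_poly)

lemma del_plus_lam_neg_lam: "del_plus_lam (neg_lam p) = neg_lam (del_plus_lam p)"
  by (simp add: del_plus_lam_def neg_lam_def poly_eq_iff coeff_map_poly coeff_pCons split: nat.split)

context novikov_poisson_algebra
begin

abbreviation qprod :: "'v poly \<Rightarrow> 'v poly \<Rightarrow> 'v poly poly"
  where "qprod \<equiv> quadratic_prod (\<bullet>\<^sub>N) (\<circ>\<^sub>N)"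

lemma vector_space_scale: "vector_space scale" ..

lemma dot_linear: "Vector_Spaces.linear scale scale (\<lambda>a. a \<bullet>\<^sub>N b)"
    "Vector_Spaces.linear scale scale (\<lambda>b. a \<bullet>\<^sub>N b)"
  and circ_linear: "Vector_Spaces.linear scale scale (\<lambda>a. a \<circ>\<^sub>N b)"
    "Vector_Spaces.linear scale scale (\<lambda>b. a \<circ>\<^sub>N b)"
  using dot_bilinear circ_bilinear by (auto simp: bilinear_over_def)

lemma additive_dot: "additive (\<lambda>a. a \<bullet>\<^sub>N b)" "additive ((\<bullet>\<^sub>N) a)"
  and additive_circ: "additive (\<lambda>a. a \<circ>\<^sub>N b)" "additive ((\<circ>\<^sub>N) a)"
  using dot_linear circ_linear by (simp_all add: additive_def Vector_Spaces.linear_iff)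

lemmas prod_simps =
  additive_dot[THEN additive.add] additive_dot[THEN additive.zero] additive_dot[THEN additive.minus]
  additive_circ[THEN additive.add] additive_circ[THEN additive.zero] additive_circ[THEN additive.minus]

lemma prod_scale:
  "scale z a \<bullet>\<^sub>N b = scale z (a \<bullet>\<^sub>N b)" "a \<bullet>\<^sub>N scale z b = scale z (a \<bullet>\<^sub>N b)"
  "scale z a \<circ>\<^sub>N b = scale z (a \<circ>\<^sub>N b)" "a \<circ>\<^sub>N scale z b = scale z (a \<circ>\<^sub>N b)"
  using dot_linear circ_linear by (simp_all add: Vector_Spaces.linear_iff)

abbreviation qgen :: "'v \<Rightarrow> 'v \<Rightarrow> 'v poly poly"
  where "qgen \<equiv> quadratic_gen (\<bullet>\<^sub>N) (\<circ>\<^sub>N)"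

lemma additive_qgen: "additive (\<lambda>a. qgen a b)" "additive (qgen a)"
  by (simp_all add: additive_def quadratic_gen_def prod_simps)

definition const_prod :: "'v \<Rightarrow> 'v poly \<Rightarrow> 'v poly poly"
  where "const_prod a g = poly_subst del_plus_lam (qgen a) g"

lemma additive_const_prod: "additive (\<lambda>a. const_prod a g)" "additive (const_prod a)"
proof -
  have "qgen (a + a') = (\<lambda>b. qgen a b + qgen a' b)" for a a'
    by (rule ext) (rule additive.add[OF additive_qgen(1)])
  then show "additive (\<lambda>a. const_prod a g)"
    by (simp add: const_prod_def additive_def poly_subst_fun_add[OF additive_del_plus_lam]
        additive.zero[OF additive_qgen(2)])
  have "const_prod a = poly_subst del_plus_lam (qgen a)"
    by (rule ext) (simp add: const_prod_def)
  then show "additive (const_prod a)"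
    by (simp add: additive_poly_subst additive_del_plus_lam additive_qgen)
qed

lemmas const_prod_0 = additive_const_prod[THEN additive.zero]

lemma const_prod_pCons: "const_prod a (pCons b g) = qgen a b + del_plus_lam (const_prod a g)"
  unfolding const_prod_def
  by (rule poly_subst_pCons) (rule additive_del_plus_lam additive.zero[OF additive_qgen(2)])+

lemma qprod_eq: "qprod f g = poly_subst neg_lam (\<lambda>a. const_prod a g) f"
proof -
  have "neg_lam = (\<lambda>p :: 'v poly poly. - pCons 0 p)"
    "del_plus_lam = (\<lambda>p :: 'v poly poly. map_poly (pCons 0) p + pCons 0 p)"
    by (simp_all add: fun_eq_iff neg_lam_def del_plus_lam_def)
  then show ?thesis unfolding quadratic_prod_def const_prod_def by (simp only:)
qed

lemma qprod_pCons: "qprod (pCons a f) g = const_prod a g + neg_lam (qprod f g)"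
  unfolding qprod_eq by (rule poly_subst_pCons) (rule additive_neg_lam const_prod_0)+

lemma qprod_const: "qprod [:a:] g = const_prod a g"
  by (simp add: qprod_eq poly_subst_const)

lemma qprod_add_left: "additive (\<lambda>f. qprod f g)"
  unfolding qprod_eq by (rule additive_poly_subst[OF additive_neg_lam additive_const_prod(1)])

lemma qprod_add_right: "additive (qprod f)"
  by (simp add: additive_def qprod_eq additive.add[OF additive_const_prod(2)]
      poly_subst_fun_add[OF additive_neg_lam] const_prod_0)

lemma qprod_sesqui_left: "qprod (pCons 0 f) g = - pCons 0 (qprod f g)"
  by (simp only: qprod_pCons const_prod_0 neg_lam_def add_0_left)

lemma qprod_sesqui_right: "qprod f (pCons 0 g) = map_poly (pCons 0) (qprod f g) + pCons 0 (qprod f g)"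
proof -
  have "qprod f (pCons 0 g) = poly_subst neg_lam (\<lambda>a. del_plus_lam (const_prod a g)) f"
    by (simp add: qprod_eq const_prod_pCons additive.zero[OF additive_qgen(2)])
  also have "\<dots> = del_plus_lam (qprod f g)"
    unfolding qprod_eq
    by (rule poly_subst_commute[OF additive_neg_lam additive_del_plus_lam])
      (rule const_prod_0 del_plus_lam_neg_lam)+
  finally show ?thesis by (simp only: del_plus_lam_def)
qed

sublocale quadratic: sesquilinear_product qprod
  by (intro sesquilinear_product.intro qprod_add_left qprod_add_right qprod_sesqui_left qprod_sesqui_right)

lemma qprod_scale:
  defines "S \<equiv> \<lambda>z. map_poly (map_poly (scale z))"
  shows "qprod (map_poly (scale z) f) g = S z (qprod f g)"
    and "qprod f (map_poly (scale z) g) = S z (qprod f g)"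
proof -
  have W: "additive (S z)"
    unfolding S_def by (intro additive_map_poly additive_scale vector_space_scale)
  have neg: "S z (neg_lam p) = neg_lam (S z p)" for p
    by (simp add: S_def neg_lam_def poly_eq_iff coeff_map_poly coeff_pCons split: nat.split)
  have del: "S z (del_plus_lam p) = del_plus_lam (S z p)" for p
    by (simp add: S_def del_plus_lam_def poly_eq_iff coeff_map_poly coeff_pCons
        scale_right_distrib split: nat.split)
  have gen: "qgen (scale z a) b = S z (qgen a b)" "qgen a (scale z b) = S z (qgen a b)" for a b
    by (simp_all add: S_def quadratic_gen_def map_poly_pCons prod_scale)
  have const: "const_prod (scale z a) g = S z (const_prod a g)"
    "const_prod a (map_poly (scale z) g) = S z (const_prod a g)" for a g
    by (induction g) (simp_all add: const_prod_0 const_prod_pCons map_poly_pCons gen del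
        additive.add[OF W] additive.zero[OF W])
  show "qprod (map_poly (scale z) f) g = S z (qprod f g)"
    and "qprod f (map_poly (scale z) g) = S z (qprod f g)"
    by (induction f) (simp_all add: additive.zero[OF qprod_add_left] qprod_pCons map_poly_pCons const
        neg additive.add[OF W] additive.zero[OF W])
qed

lemma bilinear_qprod:
  "bilinear_over (\<lambda>z. map_poly (scale z)) (\<lambda>z. map_poly (map_poly (scale z))) qprod"
  by (auto simp: bilinear_over_def Vector_Spaces.linear_iff vector_space_map_poly vector_space_scale qprod_scale
      additive.add[OF qprod_add_left] additive.add[OF qprod_add_right])

lemma lam_prod_generators:
  assumes Z: "additive Z"
  shows "lam_prod Z qprod [:u:] [:c:]
    = [:[:[:u \<circ>\<^sub>N c:]:]:] + mult_del [:[:[:u \<bullet>\<^sub>N c:]:]:] + Z [:[:[:u \<bullet>\<^sub>N c:]:]:]"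
  by (simp add: lam_prod_def quadratic_prod_generators poly_subst_pCons[OF Z] poly_subst_0
      mult_del_def map_poly_pCons additive.zero[OF Z])

text \<open>
  In this form the symmetry under exchange of \<open>a\<close> with \<open>b\<close> and of \<open>x\<close> with \<open>y\<close> is visible, since
  \<open>W = \<partial> + x + y\<close> is symmetric: the first two terms are symmetric by left symmetry of \<open>\<circ>\<close> and its
  analogue with \<open>\<cdot>\<close>, the last two because \<open>\<cdot>\<close> is commutative. Terms in \<open>\<partial>\<close>, \<open>x\<close> and \<open>y\<close>
  separately combine into multiples of \<open>W\<close> by associativity of \<open>\<cdot>\<close> and
  \<open>(a \<cdot> b) \<circ> c = a \<cdot> (b \<circ> c)\<close>.
\<close>
lemma associator_generators:
  assumes "commuting_variables X Y"
  defines "C \<equiv> \<lambda>v. [:[:[:v:]:]:]" and "W \<equiv> \<lambda>p. mult_del p + X p + Y p"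
  shows "quadratic.associator X Y [:a:] [:b:] [:c:] =
    C ((a \<circ>\<^sub>N b) \<circ>\<^sub>N c - a \<circ>\<^sub>N (b \<circ>\<^sub>N c)) + W (C ((a \<circ>\<^sub>N b) \<bullet>\<^sub>N c - a \<circ>\<^sub>N (b \<bullet>\<^sub>N c)))
      - W (W (C ((a \<bullet>\<^sub>N b) \<bullet>\<^sub>N c))) - W (C ((a \<bullet>\<^sub>N b) \<circ>\<^sub>N c))"
proof -
  interpret nested_products qprod X Y
    by (intro nested_products.intro assms(1) quadratic.sesquilinear_product_axioms)
  let ?XY = "\<lambda>p. X p + Y p"
  have linear: "[:u, v:] = [:u:] + pCons 0 [:v:]" for u v :: 'v by simp
  have C_diff: "C (u - v) = C u - C v" for u v by (simp add: C_def)
  have XY: "lam_prod ?XY qprod [:u:] [:c:] = C (u \<circ>\<^sub>N c) + W (C (u \<bullet>\<^sub>N c))" for u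
    by (simp only: lam_prod_generators[OF additive_XY]) (simp only: C_def W_def add.assoc)
  have X: "lam_prod X qprod [:a:] [:u:]
    = C (a \<circ>\<^sub>N u) + mult_del (C (a \<bullet>\<^sub>N u)) + X (C (a \<bullet>\<^sub>N u))" for u
    by (simp only: lam_prod_generators[OF additive_X] C_def)
  have "lam_prod ?XY qprod [:u, v:] [:c:]
    = lam_prod ?XY qprod [:u:] [:c:] - ?XY (lam_prod ?XY qprod [:v:] [:c:])" for u v
    unfolding linear[of u v]
    by (simp only: lam_additive[THEN additive.add] quadratic.lam_prod_sesqui_left[OF additive_XY])
      simp
  then have left: "quadratic.left_nested X Y [:a:] [:b:] [:c:]
    = lam_prod ?XY qprod [:a \<circ>\<^sub>N b:] [:c:] - Y (lam_prod ?XY qprod [:a \<bullet>\<^sub>N b:] [:c:])"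
    by (simp add: quadratic.left_nested_def quadratic_prod_generators poly_subst_pCons[OF additive_X]
        poly_subst_0 quadratic.lam_prod_zero[OF additive_XY] additive.zero[OF additive_X])
  have "lam_prod X qprod [:a:] [:u, v:] = lam_prod X qprod [:a:] [:u:]
     + mult_del (lam_prod X qprod [:a:] [:v:]) + X (lam_prod X qprod [:a:] [:v:])" for u v
    unfolding linear[of u v]
    by (simp only: lam_additive[THEN additive.add]
        quadratic.lam_prod_sesqui_right[OF additive_X D_X] add.assoc)
  then have right: "quadratic.right_nested X Y [:a:] [:b:] [:c:]
    = lam_prod X qprod [:a:] [:b \<circ>\<^sub>N c:] + W (lam_prod X qprod [:a:] [:b \<bullet>\<^sub>N c:])"
    by (simp add: quadratic.right_nested_def quadratic_prod_generators poly_subst_pCons[OF additive_Y]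
        poly_subst_0 quadratic.lam_prod_zero[OF additive_X] additive.zero[OF additive_Y] W_def)
  have assoc: "a \<bullet>\<^sub>N (b \<bullet>\<^sub>N c) = (a \<bullet>\<^sub>N b) \<bullet>\<^sub>N c" "a \<bullet>\<^sub>N (b \<circ>\<^sub>N c) = (a \<bullet>\<^sub>N b) \<circ>\<^sub>N c"
    by (simp_all add: dot_assoc dot_circ)
  show ?thesis
    unfolding quadratic.associator_def left right XY X assoc C_diff
    by (simp add: W_def var_simps algebra_simps)
qed

lemma conformal_left_symmetric_qprod:
  "quadratic.associator mult_lam mult_mu a b c = quadratic.associator mult_mu mult_lam b a c"
proof (rule quadratic.left_symmetric_from_generators)
  fix a b c
  show "quadratic.associator mult_lam mult_mu [:a:] [:b:] [:c:]
     = quadratic.associator mult_mu mult_lam [:b:] [:a:] [:c:]"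
    unfolding associator_generators[OF commuting_lam_mu] associator_generators[OF commuting_mu_lam]
      left_symmetric[of a b c] circ_dot[of a b c] dot_commute[of a b]
    by (simp only: ac_simps)
qed

sublocale quadratic: left_symmetric_conformal_algebra "free_act scale" qprod
proof (intro left_symmetric_conformal_algebra.intro module_free_act vector_space_scale
    left_symmetric_conformal_algebra_axioms.intro)
  show "bilinear_over (\<lambda>z. free_act scale [:z:]) (\<lambda>z. map_poly (free_act scale [:z:])) qprod"
    by (simp only: free_act_const[OF vector_space_scale] bilinear_qprod)
  show "qprod (free_act scale [:0, 1:] a) b = - pCons 0 (qprod a b)" for a b
    by (simp only: free_act_var[OF vector_space_scale] qprod_sesqui_left)
  show "qprod a (free_act scale [:0, 1:] b)
      = map_poly (free_act scale [:0, 1:]) (qprod a b) + pCons 0 (qprod a b)" for a b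
    by (simp only: free_act_var[OF vector_space_scale] qprod_sesqui_right)
  fix a b c
  have swap: "mult_lam_mu = (\<lambda>p. mult_lam p + mult_mu p)"
    and swap': "(\<lambda>p. mult_mu p + mult_lam p) = (\<lambda>p :: 'v poly poly poly. mult_lam p + mult_mu p)"
    by (simp_all add: fun_eq_iff mult_lam_mu_def add.commute)
  show "poly_subst mult_lam (\<lambda>u. lam_prod mult_lam_mu qprod u c) (qprod a b)
         - poly_subst mult_mu (\<lambda>u. lam_prod mult_lam qprod a u) (qprod b c)
       = poly_subst mult_mu (\<lambda>u. lam_prod mult_lam_mu qprod u c) (qprod b a)
         - poly_subst mult_lam (\<lambda>u. lam_prod mult_mu qprod b u) (qprod a c)"
    using conformal_left_symmetric_qprod[of a b c]
    unfolding quadratic.associator_def quadratic.left_nested_def quadratic.right_nested_def swap swap' .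
qed

section \<open>Ideals of the quadratic conformal algebra\<close>

text \<open>
  The subscript shift is written \<open>coeff (pCons 0 f) n\<close>: this is the coefficient of \<open>f\<close> at
  \<open>n - 1\<close>, read as \<open>0\<close> for \<open>n = 0\<close>. The sign \<open>(- 1)\<^sup>n\<close> comes from \<open>(\<partial>\<^sup>n a)\<^sub>\<lambda> = (- \<lambda>)\<^sup>n a\<^sub>\<lambda>\<close>.
\<close>
lemma coeff_qprod_const_right:
  "coeff (qprod f [:b:]) n = (uminus ^^ n)
     [:coeff f n \<circ>\<^sub>N b - coeff (pCons 0 f) n \<bullet>\<^sub>N b, coeff f n \<bullet>\<^sub>N b:]"
proof (induction f arbitrary: n)
  case 0
  have "(uminus ^^ n) (0 :: 'v poly) = 0" by (induction n) auto
  then show ?case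
    by (simp add: additive.zero[OF qprod_add_left] prod_simps coeff_pCons split: nat.split)
next
  case (pCons a f)
  have "const_prod a [:b:] = qgen a b"
    by (simp add: const_prod_def poly_subst_const)
  then show ?case
    by (auto simp: qprod_pCons neg_lam_def quadratic_gen_def coeff_pCons pCons.IH prod_simps
        split: nat.split)
qed

text \<open>
  On generators \<open>b\<^sub>\<lambda> a = b \<circ> a + (\<partial> + \<lambda>)(b \<cdot> a)\<close>, so \<open>b\<^sub>\<lambda> f\<close> is a polynomial in \<open>\<partial> + \<lambda>\<close> with
  coefficients in \<open>V\<close>.
\<close>
lemma qprod_const_left:
  "qprod [:b:] f = poly_subst del_plus_lam (\<lambda>v. [:[:v:]:])
     (map_poly ((\<circ>\<^sub>N) b) f + pCons 0 (map_poly ((\<bullet>\<^sub>N) b) f))"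
  unfolding qprod_const
proof (induction f)
  case 0
  show ?case by (simp add: const_prod_0 poly_subst_0)
next
  case (pCons a f)
  let ?h = "\<lambda>f. map_poly ((\<circ>\<^sub>N) b) f + pCons 0 (map_poly ((\<bullet>\<^sub>N) b) f)"
  have "?h (pCons a f) = pCons (b \<circ>\<^sub>N a) ([:b \<bullet>\<^sub>N a:] + ?h f)"
    by (simp add: map_poly_pCons prod_simps add_ac)
  moreover have "qgen b a = [:[:b \<circ>\<^sub>N a:]:] + del_plus_lam [:[:b \<bullet>\<^sub>N a:]:]"
    by (simp add: quadratic_gen_def del_plus_lam_def map_poly_pCons)
  ultimately show ?case
    by (simp only: const_prod_pCons pCons.IH poly_subst_pCons[OF additive_del_plus_lam] pCons_0_0
        poly_subst_add[OF additive_del_plus_lam quadratic.additive_embed] poly_subst_const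
        additive.add[OF additive_del_plus_lam] add.assoc)
qed

text \<open>Passing from \<open>\<partial> + \<lambda>\<close> to \<open>\<lambda>\<close> does not change the leading coefficient.\<close>
lemma lead_coeff_del_plus_lam:
  "degree h \<le> n \<Longrightarrow> coeff (poly_subst del_plus_lam (\<lambda>v. [:[:v:]:]) h) n = [:coeff h n:]"
proof (induction h arbitrary: n)
  case 0
  show ?case by (simp add: poly_subst_0)
next
  case (pCons a h)
  show ?case
  proof (cases "h = 0")
    case True
    then show ?thesis by (simp add: poly_subst_const coeff_pCons split: nat.split)
  next
    case False
    then obtain k where k: "n = Suc k" "degree h \<le> k"
      using pCons.prems by (cases n) auto
    have "coeff h (Suc k) = 0" using k by (intro coeff_eq_0) simp
    then show ?thesis
      using k by (simp add: poly_subst_pCons[OF additive_del_plus_lam] coeff_del_plus_lam pCons.IH)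
  qed
qed

definition skew_annihilator :: "'v set"
  where "skew_annihilator = {a. \<forall>b. a \<bullet>\<^sub>N b = 0 \<and> b \<circ>\<^sub>N a = - (a \<circ>\<^sub>N b)}"

text \<open>
  The condition \<open>a \<cdot> V = 0\<close> passes to \<open>a \<circ> d\<close> by \<open>b \<cdot> (a \<circ> d) = (b \<cdot> a) \<circ> d\<close>, and to \<open>d \<circ> a\<close>
  because skewness identifies the two products up to sign. Skewness is in turn inherited by \<open>a \<circ> d\<close>:
  with right commutativity it gives \<open>a \<circ> (b \<circ> d) = (a \<circ> b) \<circ> d\<close>, so the associator of \<open>a\<close>, \<open>b\<close>, \<open>d\<close> vanishes, and left symmetry turns this into
  \<open>b \<circ> (a \<circ> d) = (b \<circ> a) \<circ> d\<close>.
\<close>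
lemma np_ideal_skew_annihilator: "np_ideal skew_annihilator"
  unfolding np_ideal_def
proof (intro conjI ballI allI)
  show "subspace skew_annihilator"
    by (rule subspaceI) (auto simp: skew_annihilator_def prod_simps prod_scale)
next
  fix a d assume a: "a \<in> skew_annihilator"
  then have ann: "a \<bullet>\<^sub>N b = 0" and skew: "b \<circ>\<^sub>N a = - (a \<circ>\<^sub>N b)" for b
    by (auto simp: skew_annihilator_def)
  have "a \<bullet>\<^sub>N d = 0" by (rule ann)
  then show "a \<bullet>\<^sub>N d \<in> skew_annihilator"
    by (simp add: skew_annihilator_def prod_simps)
  have "(a \<circ>\<^sub>N d) \<bullet>\<^sub>N b = 0" for b
  proof -
    have "(a \<circ>\<^sub>N d) \<bullet>\<^sub>N b = (b \<bullet>\<^sub>N a) \<circ>\<^sub>N d"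
      by (simp only: dot_commute[of "a \<circ>\<^sub>N d"] dot_circ)
    also have "\<dots> = 0" by (simp add: dot_commute[of b a] ann prod_simps)
    finally show ?thesis .
  qed
  moreover have "b \<circ>\<^sub>N (a \<circ>\<^sub>N d) = - ((a \<circ>\<^sub>N d) \<circ>\<^sub>N b)" for b
  proof -
    have "a \<circ>\<^sub>N (b \<circ>\<^sub>N d) = (a \<circ>\<^sub>N b) \<circ>\<^sub>N d"
    proof -
      have "a \<circ>\<^sub>N (b \<circ>\<^sub>N d) = - ((b \<circ>\<^sub>N d) \<circ>\<^sub>N a)" by (simp add: skew)
      also have "\<dots> = - ((b \<circ>\<^sub>N a) \<circ>\<^sub>N d)" by (simp add: right_commute)
      also have "\<dots> = (a \<circ>\<^sub>N b) \<circ>\<^sub>N d" by (simp add: skew[of b] prod_simps)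
      finally show ?thesis .
    qed
    then have "b \<circ>\<^sub>N (a \<circ>\<^sub>N d) = (b \<circ>\<^sub>N a) \<circ>\<^sub>N d"
      using left_symmetric[of a b d] by simp
    also have "\<dots> = - ((a \<circ>\<^sub>N b) \<circ>\<^sub>N d)" by (simp add: skew[of b] prod_simps)
    also have "\<dots> = - ((a \<circ>\<^sub>N d) \<circ>\<^sub>N b)" by (simp add: right_commute)
    finally show ?thesis .
  qed
  ultimately show ad: "a \<circ>\<^sub>N d \<in> skew_annihilator"
    by (simp add: skew_annihilator_def)
  then show "d \<circ>\<^sub>N a \<in> skew_annihilator"
    by (simp add: skew[of d]) (simp add: skew_annihilator_def prod_simps)
qed

lemma np_ideal_constants:
  assumes "quadratic.conformal_ideal I"
  shows "np_ideal {v. [:v:] \<in> I}"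
proof -
  have I: "quadratic.subspace I"
    and coeffs: "\<And>f g n. f \<in> I \<Longrightarrow> coeff (qprod f g) n \<in> I"
      "\<And>f g n. f \<in> I \<Longrightarrow> coeff (qprod g f) n \<in> I"
    using assms by (auto simp: quadratic.conformal_ideal_def)
  \<comment> \<open>\<open>a \<cdot> b\<close> is the \<open>\<lambda>\<close>-coefficient; then \<open>\<partial>(a \<cdot> b)\<close> can be subtracted from the constant one\<close>
  have closed: "[:a \<bullet>\<^sub>N b:] \<in> I \<and> [:a \<circ>\<^sub>N b:] \<in> I" if
    "\<And>n. coeff (qprod [:a:] [:b:]) n \<in> I" for a b
  proof -
    have dot: "[:a \<bullet>\<^sub>N b:] \<in> I" using that[of 1] by (simp add: quadratic_prod_generators)
    have both: "[:a \<circ>\<^sub>N b, a \<bullet>\<^sub>N b:] \<in> I" using that[of 0] by (simp add: quadratic_prod_generators)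
    have "pCons 0 [:a \<bullet>\<^sub>N b:] \<in> I"
      using quadratic.subspace_scale[OF I dot, of "[:0, 1:]"] by (simp only: free_act_var[OF vector_space_scale])
    from quadratic.subspace_diff[OF I both this] dot show ?thesis by simp
  qed
  show ?thesis
    unfolding np_ideal_def
  proof (intro conjI ballI allI)
    show "subspace {v. [:v:] \<in> I}"
    proof (rule subspaceI)
      show "0 \<in> {v. [:v:] \<in> I}" using quadratic.subspace_0[OF I] by simp
      show "x + y \<in> {v. [:v:] \<in> I}" if "x \<in> {v. [:v:] \<in> I}" "y \<in> {v. [:v:] \<in> I}" for x y
        using quadratic.subspace_add[OF I, of "[:x:]" "[:y:]"] that by simp
      show "scale c x \<in> {v. [:v:] \<in> I}" if "x \<in> {v. [:v:] \<in> I}" for c x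
        using quadratic.subspace_scale[OF I, of "[:x:]" "[:c:]"] that
        by (simp add: free_act_const[OF vector_space_scale] map_poly_pCons)
    qed
  next
    fix a b assume "a \<in> {v. [:v:] \<in> I}"
    then show "a \<bullet>\<^sub>N b \<in> {v. [:v:] \<in> I}" "a \<circ>\<^sub>N b \<in> {v. [:v:] \<in> I}" "b \<circ>\<^sub>N a \<in> {v. [:v:] \<in> I}"
      using closed[of a b] closed[of b a] coeffs[of "[:a:]" "[:b:]"] by auto
  qed
qed

lemma ideal_containing_constants:
  assumes I: "quadratic.subspace I" and const: "\<And>v. [:v:] \<in> I"
  shows "I = UNIV"
proof -
  have "f \<in> I" for f
  proof (induction f)
    case 0
    show ?case by (rule quadratic.subspace_0[OF I])
  next
    case (pCons v f)
    have "[:v:] + pCons 0 f \<in> I"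
      using quadratic.subspace_add[OF I const quadratic.subspace_scale[OF I pCons.IH, of "[:0, 1:]"]]
      by (simp only: free_act_var[OF vector_space_scale])
    then show ?case by simp
  qed
  then show ?thesis by blast
qed

text \<open>
  Let \<open>a\<^sub>m\<close> be the leading coefficient of \<open>f\<close>, and \<open>b\<close> in \<open>V\<close>.
  Two coefficients of products with \<open>f\<close> are elements of \<open>V\<close>, hence \<open>0\<close>: the leading one of
  \<open>b\<^sub>\<lambda> f\<close>, which makes all of \<open>b\<^sub>\<lambda> f\<close> vanish and gives \<open>a\<^sub>m \<cdot> b = 0\<close>, and thanks to this the one of
  \<open>\<lambda>\<^sup>m\<close> in \<open>f\<^sub>\<lambda> b\<close>. Eliminating the product of \<open>b\<close> with the coefficient below \<open>a\<^sub>m\<close> leaves skewness.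
\<close>
lemma lead_coeff_in_skew_annihilator:
  assumes ideal: "quadratic.conformal_ideal I" and no_const: "\<And>v. [:v:] \<in> I \<Longrightarrow> v = 0"
    and f: "f \<in> I"
  shows "lead_coeff f \<in> skew_annihilator"
proof -
  define m where "m = degree f"
  have I: "quadratic.subspace I"
    and coeffs: "\<And>g n. coeff (qprod f g) n \<in> I" "\<And>g n. coeff (qprod g f) n \<in> I"
    using ideal f by (auto simp: quadratic.conformal_ideal_def)
  have left: "b \<circ>\<^sub>N coeff f n + b \<bullet>\<^sub>N coeff (pCons 0 f) n = 0" for b n
  proof -
    \<comment> \<open>\<open>[:b:]\<^sub>\<lambda> f\<close> is \<open>h\<close> at \<open>\<partial> + \<lambda>\<close>\<close>
    define h where "h = map_poly ((\<circ>\<^sub>N) b) f + pCons 0 (map_poly ((\<bullet>\<^sub>N) b) f)"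
    have "[:lead_coeff h:] \<in> I"
      using coeffs(2)[of "[:b:]" "degree h"]
      by (simp add: qprod_const_left lead_coeff_del_plus_lam flip: h_def)
    then have "lead_coeff h = 0" by (rule no_const)
    then have "h = 0" by simp
    then have "coeff h n = 0" by simp
    then show ?thesis
      by (simp add: h_def coeff_map_poly coeff_pCons prod_simps split: nat.splits)
  qed
  have ann: "coeff f m \<bullet>\<^sub>N b = 0" for b
    using left[of b "Suc m"] by (simp add: m_def prod_simps dot_commute[of b] coeff_eq_0)
  have right: "coeff f m \<circ>\<^sub>N b - coeff (pCons 0 f) m \<bullet>\<^sub>N b = 0" for b
  proof -
    have "(uminus ^^ m) [:coeff f m \<circ>\<^sub>N b - coeff (pCons 0 f) m \<bullet>\<^sub>N b:] \<in> I"
      using coeffs(1)[of "[:b:]" m] by (simp add: coeff_qprod_const_right ann)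
    moreover have "(uminus ^^ m) x \<in> I \<longleftrightarrow> x \<in> I" for x
      by (induction m) (auto dest: quadratic.subspace_neg[OF I])
    ultimately show ?thesis using no_const by blast
  qed
  have "b \<circ>\<^sub>N coeff f m = - (coeff f m \<circ>\<^sub>N b)" for b
    using left[of b m] right[of b] by (simp add: dot_commute eq_neg_iff_add_eq_0)
  then show ?thesis using ann by (simp add: skew_annihilator_def flip: m_def)
qed

end

lemma (in simple_novikov_poisson_algebra) simple_quadratic:
  assumes dot: "a \<bullet>\<^sub>N b \<noteq> 0"
  shows "simple_left_symmetric_conformal_algebra (free_act scale) qprod"
proof
  have "qprod [:a:] [:b:] \<noteq> 0" using dot by (simp add: quadratic_prod_generators)
  then show "\<not> (\<forall>f g. qprod f g = 0)" by blast
  have "a \<notin> skew_annihilator" using dot by (auto simp: skew_annihilator_def)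
  then have skew: "skew_annihilator = {0}"
    using no_proper_ideal np_ideal_skew_annihilator by blast
  show "\<not> (\<exists>I. quadratic.conformal_ideal I \<and> I \<noteq> {0} \<and> I \<noteq> UNIV)"
  proof (intro notI, elim exE conjE)
    fix I assume I: "quadratic.conformal_ideal I" "I \<noteq> {0}" "I \<noteq> UNIV"
    have sub: "quadratic.subspace I" using I(1) by (simp add: quadratic.conformal_ideal_def)
    have "{v. [:v:] \<in> I} \<noteq> UNIV" using ideal_containing_constants[OF sub] I(3) by blast
    then have "{v. [:v:] \<in> I} = {0}"
      using no_proper_ideal np_ideal_constants[OF I(1)] by blast
    then have "f = 0" if "f \<in> I" for f
      using lead_coeff_in_skew_annihilator[OF I(1) _ that] skew by auto
    then show False using I(2) quadratic.subspace_0[OF sub] by blast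
  qed
qed

theorem proposition4p9:
  fixes scale :: "complex \<Rightarrow> 'v::ab_group_add \<Rightarrow> 'v"
    and dot circ :: "'v \<Rightarrow> 'v \<Rightarrow> 'v"
  assumes "novikov_poisson_algebra scale dot circ"
    and "\<exists>a b. dot a b \<noteq> 0"
    and "simple_novikov_poisson_algebra scale dot circ"
  shows "simple_left_symmetric_conformal_algebra (free_act scale) (quadratic_prod dot circ)"
  using simple_novikov_poisson_algebra.simple_quadratic[OF assms(3)] assms(2) by blast

end
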